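(* Let $n,d,k,t$ be positive integers with $d<n$ and $t$ a multiple of $d$. If $$t \ge \frac{d^2}{k}\log_2\frac{en}{d} + d\log_2\frac{en}{k} + \frac{d}{k}\log_2 n,$$ then a $2t\times n$ random Boolean matrix $M$ constructed by sample-injection is $(d,k)$-resolvable with high probability, that is, with probability at least $1-1/n$.
   Context: Let $M$ be a Boolean matrix with set of columns $C$. For a set $D\subseteq C$ of $d$ columns and a column $j\in C\setminus D$, say that $j$ is distinguishable from $D$ if there is a row $i$ of $M$ with $M[i,j]=1$ and with a $0$ in row $i$ in each of the columns of $D$. The matrix $M$ is $(d,k)$-resolvable if, for every $d$-element subset $D\subseteq C$, there are fewer than $k$ columns in $C\setminus D$ that are not distinguishable from $D$. Sample-injection: given $t$, a multiple of $d$, the random $2t\times n$ matrix $M$ is built column by column: independently for each column, choose $t/d$ of the $2t$ rows uniformly at random, set the entries of the column in these rows to $1$ and all its other entries to $0$. Here $e$ is the base of the natural logarithm. *)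

theory Defs
  imports "HOL-Probability.Product_PMF" "Jordan_Normal_Form.Matrix"
begin

definition distinguishable :: "bool mat \<Rightarrow> nat set \<Rightarrow> nat \<Rightarrow> bool" where
  "distinguishable M D j \<longleftrightarrow>
     (\<exists>i<dim_row M. M $$ (i, j) \<and> (\<forall>l\<in>D. \<not> M $$ (i, l)))"

definition resolvable :: "nat \<Rightarrow> nat \<Rightarrow> bool mat \<Rightarrow> bool" where
  "resolvable d k M \<longleftrightarrow>
     (\<forall>D\<subseteq>{..<dim_col M}. card D = d \<longrightarrow>
        card {j \<in> {..<dim_col M} - D. \<not> distinguishable M D j} < k)"

definition column_supports :: "nat \<Rightarrow> nat \<Rightarrow> nat set set" where
  "column_supports d t = {R. R \<subseteq> {..<2 * t} \<and> card R = t div d}"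

text \<open>The next two facts ensure that the uniform distribution on the column supports is
  the intended one: \<^const>\<open>pmf_of_set\<close> is unspecified on empty and on infinite sets.\<close>

lemma finite_column_supports: "finite (column_supports d t)"
  by (simp add: column_supports_def)

lemma column_supports_nonempty: "column_supports d t \<noteq> {}"
proof -
  have "t div d \<le> card {..<2 * t}"
    by (simp add: le_trans[OF div_le_dividend])
  then obtain R where "R \<subseteq> {..<2 * t}" "card R = t div d"
    by (meson obtain_subset_with_card_n)
  then show ?thesis
    by (auto simp: column_supports_def)
qed

text \<open>\<^const>\<open>Pi_pmf\<close> draws the supports of the columns \<open>0, \<dots>, n - 1\<close> independently;
  its default value (here \<open>{}\<close>) is only used for indices that are not columns.\<close>

definition sample_injection :: "nat \<Rightarrow> nat \<Rightarrow> nat \<Rightarrow> bool mat pmf" where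
  "sample_injection d t n =
     map_pmf (\<lambda>S. mat (2 * t) n (\<lambda>(i, j). i \<in> S j))
       (Pi_pmf {..<n} {} (\<lambda>_. pmf_of_set (column_supports d t)))"

end

theory Submission imports Defs begin

text \<open>If \<open>M\<close> is not \<open>(d,k)\<close>-resolvable, then there are disjoint column sets \<open>D\<close> of size \<open>d\<close> and
  \<open>A\<close> of size \<open>k\<close> such that the support of every column in \<open>A\<close> is covered by the union \<open>U\<close> of the
  supports of the columns in \<open>D\<close>. Since \<open>|U| \<le> d (t/d) = t\<close> is at most half of the number of rows,
  a random support lies in \<open>U\<close> with probability at most \<open>2\<^sup>-\<^sup>t\<^sup>/\<^sup>d\<close>, and the union bound over \<open>(D, A)\<close>
  gives failure probability at most \<open>(en/d)\<^sup>d (en/k)\<^sup>k 2\<^sup>-\<^sup>k\<^sup>t\<^sup>/\<^sup>d \<le> 1/n\<close>.\<close>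

text \<open>Each factor \<open>2 * m - i\<close> of the right-hand falling factorial is at least
  twice the factor \<open>m - i\<close> on the left. The induction adds one factor at a time through
  the absorption identity.\<close>

lemma power_two_times_binomial_le: "2 ^ s * (m choose s) \<le> (2 * m) choose s"
proof (induction s)
  case 0
  then show ?case by simp
next
  case (Suc s)
  have absorb: "Suc s * (N choose Suc s) = (N - s) * (N choose s)" for N :: nat
    by (simp only: binomial_absorption binomial_absorb_comp)
  have "Suc s * (2 ^ Suc s * (m choose Suc s)) = 2 * 2 ^ s * (Suc s * (m choose Suc s))"
    by (simp only: power_Suc ac_simps)
  also have "\<dots> = (2 * (m - s)) * (2 ^ s * (m choose s))"
    unfolding absorb by simp
  \<comment> \<open>For \<open>s > m\<close> the truncated difference \<open>m - s\<close> is 0, so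
    the inequality of the first factors survives.\<close>
  also have "\<dots> \<le> (2 * m - s) * ((2 * m) choose s)"
    using Suc.IH by (intro mult_mono) auto
  also have "\<dots> = Suc s * ((2 * m) choose Suc s)"
    by (simp only: absorb)
  finally show ?case
    by (simp only: Suc_mult_le_cancel1)
qed

text \<open>\<open>k ^ k / fact k\<close> is a single term of the exponential series at
  \<open>k\<close>, whose terms are all nonnegative.\<close>

lemma power_le_fact_times_exp: "real k ^ k \<le> fact k * exp (real k)"
proof -
  have "real k ^ k / fact k \<le> (\<Sum>i\<le>k. real k ^ i / fact i)"
    by (rule member_le_sum) auto
  also have "\<dots> \<le> exp (real k)"
  proof -
    have "(\<lambda>i. real k ^ i / fact i) sums exp (real k)"
      using exp_converges[of "real k"] by (simp add: field_simps scaleR_conv_of_real)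
    then show ?thesis
      by (metis (no_types, lifting) divide_nonneg_nonneg fact_ge_zero finite_atMost of_nat_0_le_iff
            sum_le_suminf sums_iff zero_le_power)
  qed
  finally show ?thesis
    by (simp add: field_simps)
qed

text \<open>The binomial is at most \<open>n ^ k / fact k\<close>, and the preceding bound replaces
  \<open>1 / fact k\<close> by \<open>(exp 1 / k) ^ k\<close>.\<close>

lemma binomial_le_exp_power:
  assumes "k > 0"
  shows "real (n choose k) \<le> (exp 1 * real n / real k) ^ k"
proof -
  have "real (n choose k) * real k ^ k \<le> real (n choose k) * (fact k * exp (real k))"
    by (intro mult_left_mono power_le_fact_times_exp) auto
  also have "\<dots> = real ((n choose k) * fact k) * exp (real k)"
    by simp
  also have "\<dots> \<le> real (n ^ k) * exp (real k)"
    by (intro mult_right_mono) (use binomial_fact_pow[of n k] of_nat_mono in blast, simp)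
  also have "\<dots> = (exp 1 * real n) ^ k"
    by (simp add: power_mult_distrib flip: exp_of_nat_mult)
  finally show ?thesis
    using assms by (simp add: power_divide pos_le_divide_eq)
qed

text \<open>A bound on all conditional probabilities passes to their average. This allows the
  supports of the columns in \<open>D\<close> to be fixed before the others are drawn.\<close>

lemma prob_bind_pmf_le:
  assumes "\<And>x. x \<in> set_pmf p \<Longrightarrow> measure_pmf.prob (f x) X \<le> c" and "c \<ge> 0"
  shows "measure_pmf.prob (bind_pmf p f) X \<le> c"
proof -
  have "emeasure (measure_pmf (bind_pmf p f)) X = (\<integral>\<^sup>+x. emeasure (measure_pmf (f x)) X \<partial>measure_pmf p)"
    by (rule emeasure_bind_pmf)
  also have "\<dots> \<le> (\<integral>\<^sup>+x. ennreal c \<partial>measure_pmf p)"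
    by (intro nn_integral_mono_AE)
      (auto simp: AE_measure_pmf_iff measure_pmf.emeasure_eq_measure assms)
  also have "\<dots> = ennreal c"
    by (simp add: measure_pmf.emeasure_space_1)
  finally show ?thesis
    using assms(2) by (simp add: measure_pmf.emeasure_eq_measure)
qed

text \<open>Counting supports gives at most the ratio of \<open>t choose s\<close> to
  \<open>2 * t choose s\<close> with \<open>s = t div d\<close>, and doubling the upper index gains
  a factor of at least \<open>2 ^ s\<close>.\<close>

lemma prob_column_support_subset_le:
  assumes "finite U" and "card U \<le> t"
  shows "measure_pmf.prob (pmf_of_set (column_supports d t)) {R. R \<subseteq> U} \<le> (1 / 2) ^ (t div d)"
proof -
  let ?s = "t div d"
  have "card (column_supports d t \<inter> {R. R \<subseteq> U}) \<le> card {R. R \<subseteq> U \<and> card R = ?s}"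
    using assms(1) by (intro card_mono) (auto simp: column_supports_def)
  also have "\<dots> = card U choose ?s"
    by (rule n_subsets[OF assms(1)])
  also have "\<dots> \<le> t choose ?s"
    using assms(2) by (rule binomial_right_mono)
  finally have "2 ^ ?s * card (column_supports d t \<inter> {R. R \<subseteq> U}) \<le> 2 ^ ?s * (t choose ?s)"
    by simp
  also have "\<dots> \<le> (2 * t) choose ?s"
    by (rule power_two_times_binomial_le)
  also have "\<dots> = card (column_supports d t)"
    using n_subsets[of "{..<2 * t}" ?s] by (simp add: column_supports_def)
  finally have "real (2 ^ ?s * card (column_supports d t \<inter> {R. R \<subseteq> U})) \<le> card (column_supports d t)"
    by (rule of_nat_mono)
  moreover have "card (column_supports d t) > 0"
    using finite_column_supports column_supports_nonempty by (simp add: card_gt_0_iff)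
  ultimately show ?thesis
    by (simp add: measure_pmf_of_set finite_column_supports column_supports_nonempty
        power_divide field_simps)
qed

text \<open>Once the columns in \<open>D\<close> are drawn, their union is a fixed set of at most
  \<open>t\<close> rows. The columns in \<open>A\<close> lie outside \<open>D\<close>, so they are
  still independent and each contributes one factor.\<close>

lemma prob_columns_covered_le:
  assumes "finite I" and "D \<subseteq> I" and "A \<subseteq> I - D" and "card D = d"
  shows "measure_pmf.prob (Pi_pmf I {} (\<lambda>_. pmf_of_set (column_supports d t)))
           {S. \<forall>j\<in>A. S j \<subseteq> (\<Union>l\<in>D. S l)} \<le> (1 / 2) ^ (t div d * card A)"
proof -
  let ?p = "pmf_of_set (column_supports d t)"
  let ?P = "\<lambda>J. Pi_pmf J {} (\<lambda>_. ?p)"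
  let ?E = "{S. \<forall>j\<in>A. S j \<subseteq> (\<Union>l\<in>D. S l)}"
  have finD: "finite D" and finA: "finite A"
    using assms finite_subset by blast+
  have "?P I = ?P (D \<union> (I - D))"
    using assms(2) by (simp add: Un_absorb1)
  \<comment> \<open>The independent draw is split into two stages: first \<open>f\<close> on
    \<open>D\<close>, then \<open>g\<close> on the remaining columns.\<close>
  also have "\<dots> = bind_pmf (?P D) (\<lambda>f. map_pmf (\<lambda>g x. if x \<in> D then f x else g x) (?P (I - D)))"
    using assms(1) finD by (subst Pi_pmf_union)
      (auto simp: pair_pmf_def map_bind_pmf map_pmf_def bind_assoc_pmf bind_return_pmf)
  finally have eq: "?P I = \<dots>" .
  show ?thesis
    unfolding eq
  proof (rule prob_bind_pmf_le)
    fix f assume f: "f \<in> set_pmf (?P D)"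
    define U where "U = (\<Union>l\<in>D. f l)"
    have f_mem: "f l \<in> column_supports d t" if "l \<in> D" for l
      using f that finD
      by (auto simp: set_Pi_pmf PiE_dflt_def finite_column_supports column_supports_nonempty)
    have finU: "finite U"
      using f_mem finD unfolding U_def column_supports_def
      by (auto intro: finite_subset[of _ "{..<2 * t}"])
    have "card U \<le> (\<Sum>l\<in>D. card (f l))"
      unfolding U_def by (rule card_UN_le[OF finD])
    also have "\<dots> = d * (t div d)"
      using f_mem assms(4) by (simp add: column_supports_def)
    finally have cardU: "card U \<le> t"
      using times_div_less_eq_dividend le_trans by blast
    have "measure_pmf.prob (map_pmf (\<lambda>g x. if x \<in> D then f x else g x) (?P (I - D))) ?E
        = measure_pmf.prob (?P (I - D)) {g. \<forall>j\<in>A. g j \<subseteq> U}"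
      using assms(3) by (auto simp: U_def vimage_def intro!: arg_cong[where f = "measure_pmf.prob _"])
    \<comment> \<open>Columns outside \<open>A\<close> are left unconstrained by
      \<open>UNIV\<close>, which makes the event a product over all of \<open>I - D\<close>; their
      factors are 1.\<close>
    also have "{g. \<forall>j\<in>A. g j \<subseteq> U} = Pi (I - D) (\<lambda>j. if j \<in> A then {R. R \<subseteq> U} else UNIV)"
      using assms(3) by (auto simp: Pi_def split: if_splits)
    also have "measure_pmf.prob (?P (I - D)) \<dots>
        = (\<Prod>j\<in>I - D. measure_pmf.prob ?p (if j \<in> A then {R. R \<subseteq> U} else UNIV))"
      using assms(1) by (intro measure_Pi_pmf_Pi) auto
    also have "\<dots> = (\<Prod>j\<in>A. measure_pmf.prob ?p {R. R \<subseteq> U})"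
      using assms(1,3) by (intro prod.mono_neutral_cong_right) auto
    also have "\<dots> = measure_pmf.prob ?p {R. R \<subseteq> U} ^ card A"
      by simp
    also have "\<dots> \<le> ((1 / 2) ^ (t div d)) ^ card A"
      by (intro power_mono prob_column_support_subset_le finU cardU) auto
    finally show "measure_pmf.prob (map_pmf (\<lambda>g x. if x \<in> D then f x else g x) (?P (I - D))) ?E
        \<le> (1 / 2) ^ (t div d * card A)"
      by (simp add: power_mult)
  qed auto
qed

text \<open>Column \<open>j\<close> is indistinguishable from \<open>D\<close> when each of its
  1-rows has a 1 in some column of \<open>D\<close>. The bound on \<open>S j\<close> matters because
  the matrix shows only rows below \<open>m\<close>. Any \<open>k\<close> of the bad columns serve
  as \<open>A\<close>.\<close>

lemma not_resolvable_imp_columns_covered: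
  assumes "\<not> resolvable d k (mat m n (\<lambda>(i, j). i \<in> S j))" and "\<And>j. j < n \<Longrightarrow> S j \<subseteq> {..<m}"
  obtains D A where "D \<subseteq> {..<n}" "card D = d" "A \<subseteq> {..<n} - D" "card A = k"
    "\<forall>j\<in>A. S j \<subseteq> (\<Union>l\<in>D. S l)"
proof -
  let ?M = "mat m n (\<lambda>(i, j). i \<in> S j)"
  obtain D where D: "D \<subseteq> {..<n}" "card D = d"
    and "card {j \<in> {..<n} - D. \<not> distinguishable ?M D j} \<ge> k"
    using assms(1) by (auto simp: resolvable_def not_less)
  then obtain A where A: "A \<subseteq> {j \<in> {..<n} - D. \<not> distinguishable ?M D j}" "card A = k"
    by (meson obtain_subset_with_card_n)
  have "S j \<subseteq> (\<Union>l\<in>D. S l)" if "j \<in> A" for j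
  proof
    fix i assume i: "i \<in> S j"
    have j: "j < n" "\<not> distinguishable ?M D j"
      using A(1) that by auto
    then have "i < m"
      using i assms(2) by blast
    then show "i \<in> (\<Union>l\<in>D. S l)"
      using j i D(1) by (fastforce simp: distinguishable_def subset_iff)
  qed
  with D A show ?thesis
    by (intro that[of D A] ballI) blast+
qed

lemma prob_not_resolvable_le:
  "measure_pmf.prob (sample_injection d t n) {M. \<not> resolvable d k M}
     \<le> real (n choose d) * real (n choose k) * (1 / 2) ^ (t div d * k)"
proof -
  let ?P = "Pi_pmf {..<n} {} (\<lambda>_. pmf_of_set (column_supports d t))"
  let ?X = "\<lambda>c. {D. D \<subseteq> {..<n} \<and> card D = c}"
  let ?T = "{(D, A) \<in> ?X d \<times> ?X k. A \<subseteq> {..<n} - D}"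
  let ?E = "\<lambda>(D, A). {S. \<forall>j\<in>A. S j \<subseteq> (\<Union>l\<in>D. S l)}"
  have finX: "finite (?X c)" for c
    by (rule finite_subset[of _ "Pow {..<n}"]) auto
  have T: "finite ?T"
    by (rule finite_subset[of _ "?X d \<times> ?X k"]) (auto simp: finX simp del: finite_Collect_conjI)
  have "measure_pmf.prob (sample_injection d t n) {M. \<not> resolvable d k M}
      = measure_pmf.prob ?P {S. \<not> resolvable d k (mat (2 * t) n (\<lambda>(i, j). i \<in> S j))}"
    by (simp add: sample_injection_def vimage_def)
  also have "\<dots> \<le> measure_pmf.prob ?P (\<Union>x\<in>?T. ?E x)"
  \<comment> \<open>The inclusion of events is only claimed almost surely, since it uses that the
    drawn supports lie within the \<open>2 * t\<close> rows.\<close>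
  proof (rule measure_pmf.finite_measure_mono_AE)
    have "S \<in> (\<Union>x\<in>?T. ?E x)"
      if S: "S \<in> set_pmf ?P" and nr: "\<not> resolvable d k (mat (2 * t) n (\<lambda>(i, j). i \<in> S j))" for S
    proof -
      have "S j \<subseteq> {..<2 * t}" if "j < n" for j
        using S that by (auto simp: set_Pi_pmf PiE_dflt_def finite_column_supports
            column_supports_nonempty) (auto simp: column_supports_def)
      then obtain D A where "D \<subseteq> {..<n}" "card D = d" "A \<subseteq> {..<n} - D" "card A = k"
        "\<forall>j\<in>A. S j \<subseteq> (\<Union>l\<in>D. S l)"
        using not_resolvable_imp_columns_covered[OF nr] by blast
      then show ?thesis
        by (intro UN_I[of "(D, A)"]) auto
    qed
    then show "AE S in ?P. S \<in> {S. \<not> resolvable d k (mat (2 * t) n (\<lambda>(i, j). i \<in> S j))}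
        \<longrightarrow> S \<in> (\<Union>x\<in>?T. ?E x)"
      by (simp add: AE_measure_pmf_iff)
  qed auto
  also have "\<dots> \<le> (\<Sum>x\<in>?T. measure_pmf.prob ?P (?E x))"
    using T by (intro measure_pmf.finite_measure_subadditive_finite) auto
  also have "\<dots> \<le> (\<Sum>x\<in>?T. (1 / 2) ^ (t div d * k))"
  proof (rule sum_mono)
    fix x assume "x \<in> ?T"
    then obtain D A where "x = (D, A)" "D \<subseteq> {..<n}" "card D = d" "card A = k" "A \<subseteq> {..<n} - D"
      by auto
    then show "measure_pmf.prob ?P (?E x) \<le> (1 / 2) ^ (t div d * k)"
      using prob_columns_covered_le[of "{..<n}" D A d t] by simp
  qed
  also have "\<dots> = real (card ?T) * (1 / 2) ^ (t div d * k)"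
    by simp
  \<comment> \<open>Disjointness of \<open>D\<close> and \<open>A\<close> was needed for each single
    probability; the count of pairs drops it.\<close>
  also have "\<dots> \<le> real (card (?X d \<times> ?X k)) * (1 / 2) ^ (t div d * k)"
    by (intro mult_right_mono of_nat_mono card_mono finite_cartesian_product finX) auto
  also have "card (?X d \<times> ?X k) = (n choose d) * (n choose k)"
    using n_subsets[of "{..<n}" d] n_subsets[of "{..<n}" k] by (simp add: card_cartesian_product)
  finally show ?thesis
    by simp
qed

theorem theorem2:
  fixes n d k t :: nat
  assumes "n > 0" and "d > 0" and "k > 0" and "t > 0"
    and "d < n"
    and "d dvd t"
    and "real t \<ge> (real d)\<^sup>2 / real k * log 2 (exp 1 * real n / real d)
                  + real d * log 2 (exp 1 * real n / real k)
                  + real d / real k * log 2 (real n)"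
  shows "measure_pmf.prob (sample_injection d t n) {M. resolvable d k M} \<ge> 1 - 1 / real n"
proof -
  define a b where "a = exp 1 * real n / real d" and "b = exp 1 * real n / real k"
  obtain s where s: "t = d * s"
    using \<open>d dvd t\<close> by blast
  have pos: "a > 0" "b > 0"
    using assms by (simp_all add: a_def b_def)
  have "real d * (real d * log 2 a + real k * log 2 b + log 2 (real n)) \<le> real d * (real s * real k)"
    using assms(7) \<open>k > 0\<close> unfolding a_def[symmetric] b_def[symmetric] s
    by (simp add: field_simps power2_eq_square)
  then have "real d * log 2 a + real k * log 2 b + log 2 (real n) \<le> real (s * k)"
    using \<open>d > 0\<close> by simp
  \<comment> \<open>The three summands are the logarithms of the bounds on the number of choices of
    \<open>D\<close> and of \<open>A\<close>, and of the factor \<open>n\<close> that turns the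
    union bound into \<open>1 / n\<close>.\<close>
  then have "log 2 (a ^ d * b ^ k * real n) \<le> log 2 (2 ^ (s * k))"
    using pos \<open>n > 0\<close> by (simp add: log_mult log_nat_power)
  then have le: "a ^ d * b ^ k * real n \<le> 2 ^ (s * k)"
    using pos \<open>n > 0\<close> by (subst (asm) log_le_cancel_iff) auto
  have "measure_pmf.prob (sample_injection d t n) {M. \<not> resolvable d k M}
      \<le> real (n choose d) * real (n choose k) * (1 / 2) ^ (s * k)"
    using prob_not_resolvable_le[of d t n k] s \<open>d > 0\<close> by simp
  also have "\<dots> \<le> a ^ d * b ^ k * (1 / 2) ^ (s * k)"
    unfolding a_def b_def using assms
    by (intro mult_right_mono mult_mono binomial_le_exp_power) auto
  also have "\<dots> \<le> 1 / real n"
    using le \<open>n > 0\<close> by (simp add: power_divide field_simps)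
  finally have "measure_pmf.prob (sample_injection d t n) {M. \<not> resolvable d k M} \<le> 1 / real n" .
  moreover have "{M. \<not> resolvable d k M} = UNIV - {M. resolvable d k M}"
    by auto
  ultimately show ?thesis
    using measure_pmf.prob_compl[of "{M. resolvable d k M}" "sample_injection d t n"] by simp
qed

end
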